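(* Let $\mathbf A=(A;\cdot,\to,\leadsto,1)$ be a pseudo-hoop and let $M\subseteq A$. Let $G=M^\perp\cdot M^{\perp\perp}=\{a\cdot b\mid a\in M^\perp,\ b\in M^{\perp\perp}\}$. If there is an element $x\in A$ with $x\notin G$ such that the set $\{a\in G\mid x\le a\}$ has a least element, then $\mathbf A$ is subdirectly reducible.
   Context: A pseudo-hoop is an algebra $(A;\cdot,\to,\leadsto,1)$ of type $\langle 2,2,2,0\rangle$ such that for all $x,y,z\in A$: $x\cdot 1=x=1\cdot x$; $x\to x=1=x\leadsto x$; $(x\cdot y)\to z=x\to(y\to z)$; $(x\cdot y)\leadsto z=y\leadsto(x\leadsto z)$; and $(x\to y)\cdot x=(y\to x)\cdot y=x\cdot(x\leadsto y)=y\cdot(y\leadsto x)$. Setting $x\le y$ iff $x\to y=1$ gives a partial order with greatest element $1$. For $x,y\in A$, "$x\vee y=1$" means that the supremum of $\{x,y\}$ exists and equals $1$. For $M\subseteq A$, $M^\perp=\{x\in A\mid x\vee y=1\text{ for every }y\in M\}$ and $M^{\perp\perp}=(M^\perp)^\perp$. An algebra is subdirectly reducible if it is not subdirectly irreducible, i.e. its identity congruence is the intersection of a family of congruences each different from the identity congruence (equivalently, it is a subdirect product of algebras none of whose projections is an isomorphism). *)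

theory Defs
  imports Main
begin

text \<open>A pseudo-hoop given by a carrier set A with operations
  m (product), r (the arrow \<open>\<rightarrow>\<close>), l (the arrow \<open>\<leadsto>\<close>) and unit e.\<close>

definition pseudo_hoop ::
  "'a set \<Rightarrow> ('a \<Rightarrow> 'a \<Rightarrow> 'a) \<Rightarrow> ('a \<Rightarrow> 'a \<Rightarrow> 'a) \<Rightarrow> ('a \<Rightarrow> 'a \<Rightarrow> 'a) \<Rightarrow> 'a \<Rightarrow> bool" where
  "pseudo_hoop A m r l e \<longleftrightarrow>
     e \<in> A \<and>
     (\<forall>x\<in>A. \<forall>y\<in>A. m x y \<in> A \<and> r x y \<in> A \<and> l x y \<in> A) \<and>
     (\<forall>x\<in>A. m x e = x \<and> m e x = x) \<and>
     (\<forall>x\<in>A. r x x = e \<and> l x x = e) \<and>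
     (\<forall>x\<in>A. \<forall>y\<in>A. \<forall>z\<in>A. r (m x y) z = r x (r y z)) \<and>
     (\<forall>x\<in>A. \<forall>y\<in>A. \<forall>z\<in>A. l (m x y) z = l y (l x z)) \<and>
     (\<forall>x\<in>A. \<forall>y\<in>A. m (r x y) x = m (r y x) y \<and> m (r y x) y = m x (l x y)
                    \<and> m x (l x y) = m y (l y x))"

definition ph_le :: "('a \<Rightarrow> 'a \<Rightarrow> 'a) \<Rightarrow> 'a \<Rightarrow> 'a \<Rightarrow> 'a \<Rightarrow> bool" where
  "ph_le r e x y \<longleftrightarrow> r x y = e"

definition join_is_one :: "'a set \<Rightarrow> ('a \<Rightarrow> 'a \<Rightarrow> 'a) \<Rightarrow> 'a \<Rightarrow> 'a \<Rightarrow> 'a \<Rightarrow> bool" where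
  "join_is_one A r e x y \<longleftrightarrow>
     ph_le r e x e \<and> ph_le r e y e \<and>
     (\<forall>z\<in>A. ph_le r e x z \<and> ph_le r e y z \<longrightarrow> ph_le r e e z)"

definition perp :: "'a set \<Rightarrow> ('a \<Rightarrow> 'a \<Rightarrow> 'a) \<Rightarrow> 'a \<Rightarrow> 'a set \<Rightarrow> 'a set" where
  "perp A r e M = {x \<in> A. \<forall>y\<in>M. join_is_one A r e x y}"

definition ph_congruence ::
  "'a set \<Rightarrow> ('a \<Rightarrow> 'a \<Rightarrow> 'a) \<Rightarrow> ('a \<Rightarrow> 'a \<Rightarrow> 'a) \<Rightarrow> ('a \<Rightarrow> 'a \<Rightarrow> 'a) \<Rightarrow> ('a \<times> 'a) set \<Rightarrow> bool" where
  "ph_congruence A m r l \<theta> \<longleftrightarrow>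
     equiv A \<theta> \<and>
     (\<forall>x y u v. (x, y) \<in> \<theta> \<and> (u, v) \<in> \<theta> \<longrightarrow>
        (m x u, m y v) \<in> \<theta> \<and> (r x u, r y v) \<in> \<theta> \<and> (l x u, l y v) \<in> \<theta>)"

text \<open>Subdirectly reducible: the identity congruence is the intersection of a family
  of congruences each different from the identity (the empty intersection being A \<times> A).\<close>
definition subdirectly_reducible ::
  "'a set \<Rightarrow> ('a \<Rightarrow> 'a \<Rightarrow> 'a) \<Rightarrow> ('a \<Rightarrow> 'a \<Rightarrow> 'a) \<Rightarrow> ('a \<Rightarrow> 'a \<Rightarrow> 'a) \<Rightarrow> bool" where
  "subdirectly_reducible A m r l \<longleftrightarrow>
     (\<exists>F. (\<forall>\<theta>\<in>F. ph_congruence A m r l \<theta> \<and> \<theta> \<noteq> Id_on A) \<and>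
          (A \<times> A) \<inter> \<Inter>F = Id_on A)"

end

theory Submission
  imports Defs
begin

text \<open>
  Put \<open>P = M\<^sup>\<bottom>\<close>, \<open>Q = M\<^sup>\<bottom>\<^sup>\<bottom>\<close>, let \<open>c\<close> be the least element of \<open>G = P \<cdot> Q\<close> above \<open>x\<close>, and let
  \<open>y = c \<rightarrow> x\<close>. Minimality of \<open>c\<close> forces every \<open>z \<in> G\<close> above \<open>y\<close> to absorb both \<open>c\<close> and \<open>y\<close>
  on either side. The filters \<open>{z \<in> P. y \<le> z}\<close> and \<open>{z \<in> Q. y \<le> z}\<close> intersect in \<open>1\<close>, and
  neither is trivial: otherwise \<open>y\<close> would lie in \<open>Q\<close> or in \<open>P\<close>, hence in \<open>G\<close>, and then so would
  \<open>x = y \<cdot> c\<close>. Absorption makes both filters normal, although \<open>P\<close> and \<open>Q\<close> themselves need not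
  be, so they induce two nonidentity congruences with trivial intersection.
\<close>

section \<open>Order, residuation and divisibility in a pseudo-hoop\<close>

locale pseudo_hoop_on =
  fixes A :: "'a set"
    and m :: "'a \<Rightarrow> 'a \<Rightarrow> 'a" (infixl "\<cdot>" 75)
    and r :: "'a \<Rightarrow> 'a \<Rightarrow> 'a" (infixr "\<rightarrow>" 65)
    and l :: "'a \<Rightarrow> 'a \<Rightarrow> 'a" (infixr "\<leadsto>" 65)
    and e :: 'a
  assumes hoop: "pseudo_hoop A m r l e"
begin

abbreviation le (infix "\<sqsubseteq>" 50) where "x \<sqsubseteq> y \<equiv> ph_le r e x y"
abbreviation orth where "orth \<equiv> join_is_one A r e"
abbreviation polar where "polar \<equiv> perp A r e"

lemma unit_closed [simp]: "e \<in> A"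
  and mult_closed [simp]: "\<lbrakk>x \<in> A; y \<in> A\<rbrakk> \<Longrightarrow> x \<cdot> y \<in> A"
  and r_closed [simp]: "\<lbrakk>x \<in> A; y \<in> A\<rbrakk> \<Longrightarrow> x \<rightarrow> y \<in> A"
  and l_closed [simp]: "\<lbrakk>x \<in> A; y \<in> A\<rbrakk> \<Longrightarrow> x \<leadsto> y \<in> A"
  and mult_unit [simp]: "x \<in> A \<Longrightarrow> x \<cdot> e = x" "x \<in> A \<Longrightarrow> e \<cdot> x = x"
  and r_self [simp]: "x \<in> A \<Longrightarrow> x \<rightarrow> x = e"
  and l_self [simp]: "x \<in> A \<Longrightarrow> x \<leadsto> x = e"
  and r_mult: "\<lbrakk>x \<in> A; y \<in> A; z \<in> A\<rbrakk> \<Longrightarrow> (x \<cdot> y) \<rightarrow> z = x \<rightarrow> (y \<rightarrow> z)"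
  and l_mult: "\<lbrakk>x \<in> A; y \<in> A; z \<in> A\<rbrakk> \<Longrightarrow> (x \<cdot> y) \<leadsto> z = y \<leadsto> (x \<leadsto> z)"
  and meet_rr: "\<lbrakk>x \<in> A; y \<in> A\<rbrakk> \<Longrightarrow> (x \<rightarrow> y) \<cdot> x = (y \<rightarrow> x) \<cdot> y"
  and meet_rl: "\<lbrakk>x \<in> A; y \<in> A\<rbrakk> \<Longrightarrow> (x \<rightarrow> y) \<cdot> x = x \<cdot> (x \<leadsto> y)"
  and meet_ll: "\<lbrakk>x \<in> A; y \<in> A\<rbrakk> \<Longrightarrow> x \<cdot> (x \<leadsto> y) = y \<cdot> (y \<leadsto> x)"
  using hoop unfolding pseudo_hoop_def by metis+

text \<open>The axioms are invariant under reversing the product while exchanging the two arrows, so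
  one-sided facts transfer through this instance to their mirror images. The translations
  \<open>le_dual\<close>, \<open>orth_dual\<close> and \<open>polar_dual\<close> bring the
  order-theoretic notions back to the original ones.\<close>

lemma dual: "pseudo_hoop_on A (\<lambda>x y. y \<cdot> x) l r e"
proof (unfold_locales, unfold pseudo_hoop_def, intro conjI ballI)
qed (simp_all add: r_mult l_mult, metis meet_ll, metis meet_rr meet_rl meet_ll, metis meet_rr)

text \<open>That \<open>e\<close> is the top has to be extracted from the meet identities. With
  \<open>w = e \<rightarrow> x\<close> and \<open>p = x \<rightarrow> e\<close> one gets
  \<open>w \<rightarrow> x = p \<rightarrow> e\<close> and
  \<open>x = (w \<rightarrow> x) \<cdot> w\<close>, hence
  \<open>p = (p \<rightarrow> e) \<rightarrow> e\<close>; the auxiliary identity \<open>*\<close>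
  evaluates the right side to \<open>e\<close>.\<close>

lemma r_unit [simp]:
  assumes "x \<in> A" shows "x \<rightarrow> e = e"
proof -
  have *: "(e \<rightarrow> t) \<rightarrow> e = e" if "t \<in> A" for t
  proof -
    have "e \<rightarrow> t = (t \<rightarrow> e) \<cdot> t"
      using meet_rr[of e t] that by simp
    then have "(e \<rightarrow> t) \<rightarrow> e = (t \<rightarrow> e) \<rightarrow> (t \<rightarrow> e)"
      using that by (simp add: r_mult)
    then show ?thesis using that by simp
  qed
  define w p where "w = e \<rightarrow> x" and "p = x \<rightarrow> e"
  have A: "w \<in> A" "p \<in> A" using assms by (auto simp: w_def p_def)
  have "x \<rightarrow> w = e"
    using r_mult[of x e x] assms by (simp add: w_def)
  then have x: "x = (w \<rightarrow> x) \<cdot> w"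
    using meet_rr[of x w] assms A by simp
  have "w = p \<cdot> x"
    using meet_rr[of e x] assms by (simp add: w_def p_def)
  then have wx: "w \<rightarrow> x = p \<rightarrow> e"
    using assms A by (simp add: r_mult)
  have "p = (w \<rightarrow> x) \<rightarrow> (w \<rightarrow> e)"
    using x assms A r_mult[of "w \<rightarrow> x" w e] unfolding p_def by simp
  then have p: "p = (p \<rightarrow> e) \<rightarrow> e"
    using *[OF assms] wx by (simp add: w_def)
  have "e \<rightarrow> (p \<rightarrow> e) = p \<rightarrow> e"
    using r_mult[of e p e] A by simp
  then have "(p \<rightarrow> e) \<rightarrow> e = e"
    using *[of "p \<rightarrow> e"] A by simp
  with p show ?thesis by (simp add: p_def)
qed

lemma l_unit [simp]: "x \<in> A \<Longrightarrow> x \<leadsto> e = e"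
  by (rule pseudo_hoop_on.r_unit[OF dual])

lemma le_refl [simp]: "x \<in> A \<Longrightarrow> x \<sqsubseteq> x"
  and le_unit [simp]: "x \<in> A \<Longrightarrow> x \<sqsubseteq> e"
  by (simp_all add: ph_le_def)

lemma le_antisym: "\<lbrakk>x \<sqsubseteq> y; y \<sqsubseteq> x; x \<in> A; y \<in> A\<rbrakk> \<Longrightarrow> x = y"
  unfolding ph_le_def by (metis meet_rr mult_unit(2))

lemma le_trans:
  assumes "x \<sqsubseteq> y" "y \<sqsubseteq> z" "x \<in> A" "y \<in> A" "z \<in> A"
  shows "x \<sqsubseteq> z"
proof -
  have "x = (y \<rightarrow> x) \<cdot> y"
    using meet_rr[of x y] assms by (simp add: ph_le_def)
  then have "x \<rightarrow> z = (y \<rightarrow> x) \<rightarrow> (y \<rightarrow> z)"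
    using assms r_mult[of "y \<rightarrow> x" y z] by simp
  then show ?thesis using assms by (simp add: ph_le_def)
qed

lemma unit_r [simp]:
  assumes "x \<in> A" shows "e \<rightarrow> x = x"
  using meet_rr[of e x] assms by (metis l_unit meet_rl mult_unit(1) r_closed unit_closed)

text \<open>The shared meet term gives \<open>x = y \<cdot> (y \<leadsto> x)\<close>, and
  \<open>l_mult\<close> reduces \<open>x \<leadsto> y\<close> to
  \<open>(y \<leadsto> x) \<leadsto> e\<close>. Together with the mirror image this yields, in
  \<open>le_dual\<close>, that both arrows define the same order.\<close>

lemma le_imp_l:
  assumes "x \<sqsubseteq> y" "x \<in> A" "y \<in> A" shows "x \<leadsto> y = e"
proof -
  have "x = y \<cdot> (y \<leadsto> x)"
    using assms meet_rl[of x y] meet_ll[of x y] by (simp add: ph_le_def)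
  then have "x \<leadsto> y = (y \<leadsto> x) \<leadsto> (y \<leadsto> y)"
    using assms l_mult[of y "y \<leadsto> x" y] by simp
  then show ?thesis using assms by simp
qed

lemma le_dual: "\<lbrakk>x \<in> A; y \<in> A\<rbrakk> \<Longrightarrow> ph_le l e x y \<longleftrightarrow> x \<sqsubseteq> y"
  using le_imp_l[of x y] pseudo_hoop_on.le_imp_l[OF dual, of x y]
  by (auto simp: ph_le_def)

lemma residuation_r: "\<lbrakk>x \<in> A; y \<in> A; z \<in> A\<rbrakk> \<Longrightarrow> x \<cdot> y \<sqsubseteq> z \<longleftrightarrow> x \<sqsubseteq> y \<rightarrow> z"
  by (simp add: ph_le_def r_mult)

lemma residuation_l: "\<lbrakk>x \<in> A; y \<in> A; z \<in> A\<rbrakk> \<Longrightarrow> x \<cdot> y \<sqsubseteq> z \<longleftrightarrow> y \<sqsubseteq> x \<leadsto> z"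
  using pseudo_hoop_on.residuation_r[OF dual, of y x z] by (simp add: le_dual)

text \<open>By \<open>r_mult\<close> both bracketings have the same arrow into every
  \<open>u\<close>; taking for \<open>u\<close> each of the two products gives both
  inequalities.\<close>

lemma mult_assoc:
  assumes "x \<in> A" "y \<in> A" "z \<in> A" shows "(x \<cdot> y) \<cdot> z = x \<cdot> (y \<cdot> z)"
proof (rule le_antisym)
  have *: "((x \<cdot> y) \<cdot> z) \<rightarrow> u = (x \<cdot> (y \<cdot> z)) \<rightarrow> u" if "u \<in> A" for u
    using assms that by (simp add: r_mult)
  show "(x \<cdot> y) \<cdot> z \<sqsubseteq> x \<cdot> (y \<cdot> z)" "x \<cdot> (y \<cdot> z) \<sqsubseteq> (x \<cdot> y) \<cdot> z"
    using *[of "x \<cdot> (y \<cdot> z)"] *[of "(x \<cdot> y) \<cdot> z"] assms by (simp_all add: ph_le_def)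
qed (use assms in auto)

lemma mult_mono_left: "\<lbrakk>x \<sqsubseteq> y; x \<in> A; y \<in> A; z \<in> A\<rbrakk> \<Longrightarrow> x \<cdot> z \<sqsubseteq> y \<cdot> z"
  by (metis residuation_r le_trans le_refl mult_closed r_closed)

lemma mult_mono_right: "\<lbrakk>x \<sqsubseteq> y; x \<in> A; y \<in> A; z \<in> A\<rbrakk> \<Longrightarrow> z \<cdot> x \<sqsubseteq> z \<cdot> y"
  by (metis residuation_l le_trans le_refl mult_closed l_closed)

lemma mult_le_left: "\<lbrakk>x \<in> A; y \<in> A\<rbrakk> \<Longrightarrow> x \<cdot> y \<sqsubseteq> x"
  using mult_mono_right[of y e x] by simp

lemma mult_le_right: "\<lbrakk>x \<in> A; y \<in> A\<rbrakk> \<Longrightarrow> x \<cdot> y \<sqsubseteq> y"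
  using mult_mono_left[of x e y] by simp

lemma le_l: "\<lbrakk>x \<in> A; y \<in> A\<rbrakk> \<Longrightarrow> y \<sqsubseteq> x \<leadsto> y"
  using residuation_l[of x y y] mult_le_right[of x y] by simp

lemma le_r: "\<lbrakk>x \<in> A; y \<in> A\<rbrakk> \<Longrightarrow> y \<sqsubseteq> x \<rightarrow> y"
  using residuation_r[of y x y] mult_le_left[of y x] by simp

lemma r_app: "\<lbrakk>x \<in> A; y \<in> A\<rbrakk> \<Longrightarrow> (x \<rightarrow> y) \<cdot> x \<sqsubseteq> y"
  by (simp add: residuation_r)

lemma l_app: "\<lbrakk>x \<in> A; y \<in> A\<rbrakk> \<Longrightarrow> x \<cdot> (x \<leadsto> y) \<sqsubseteq> y"
  by (simp add: residuation_l)

lemma le_mult_r: "\<lbrakk>y \<sqsubseteq> x; x \<in> A; y \<in> A\<rbrakk> \<Longrightarrow> (x \<rightarrow> y) \<cdot> x = y"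
  using meet_rr[of x y] by (simp add: ph_le_def)

lemma le_mult_l: "\<lbrakk>y \<sqsubseteq> x; x \<in> A; y \<in> A\<rbrakk> \<Longrightarrow> x \<cdot> (x \<leadsto> y) = y"
  using meet_rl[of x y] le_mult_r[of y x] by simp

text \<open>Divisibility writes the lower bound as \<open>t = x \<cdot> (x \<leadsto> t)\<close>,
  and \<open>\<leadsto>\<close> is isotone in its second argument. So the common term of the axioms
  is the meet.\<close>

lemma meet_greatest:
  assumes "t \<sqsubseteq> x" "t \<sqsubseteq> y" "t \<in> A" "x \<in> A" "y \<in> A"
  shows "t \<sqsubseteq> x \<cdot> (x \<leadsto> y)"
proof -
  have "t = x \<cdot> (x \<leadsto> t)" using assms by (simp add: le_mult_l)
  moreover have "x \<leadsto> t \<sqsubseteq> x \<leadsto> y"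
    using assms by (metis calculation residuation_l l_closed)
  ultimately show ?thesis
    using assms mult_mono_right[of "x \<leadsto> t" "x \<leadsto> y" x] by simp
qed

text \<open>The two residuals into \<open>w\<close> form a Galois connection. Here \<open>?a\<close>
  is the largest left partner of \<open>b\<close> below \<open>w\<close>, \<open>?b\<close> is the
  largest right partner of \<open>?a\<close>, and closure gives
  \<open>?b \<rightarrow> w = ?a\<close>. As \<open>w\<close> lies below \<open>?b\<close>,
  divisibility turns this into \<open>w = ?a \<cdot> ?b\<close>.\<close>

lemma riesz_decomposition:
  assumes "a \<cdot> b \<sqsubseteq> w" "a \<in> A" "b \<in> A" "w \<in> A"
  obtains a' b' where "a' \<in> A" "b' \<in> A" "a \<sqsubseteq> a'" "b \<sqsubseteq> b'" "w = a' \<cdot> b'"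
proof
  let ?a = "b \<rightarrow> w" and ?b = "(b \<rightarrow> w) \<leadsto> w"
  show "?a \<in> A" "?b \<in> A" using assms by auto
  show "a \<sqsubseteq> ?a" using assms by (simp add: residuation_r)
  show b: "b \<sqsubseteq> ?b" using assms r_app residuation_l[of "b \<rightarrow> w" b w] by simp
  have "w \<sqsubseteq> ?b" using assms by (simp add: le_l)
  moreover have "?b \<rightarrow> w = ?a"
  proof (rule le_antisym)
    have "(?b \<rightarrow> w) \<cdot> b \<sqsubseteq> (?b \<rightarrow> w) \<cdot> ?b"
      using b assms by (intro mult_mono_right) auto
    moreover have "(?b \<rightarrow> w) \<cdot> ?b \<sqsubseteq> w" using assms by (intro r_app) auto
    ultimately have "(?b \<rightarrow> w) \<cdot> b \<sqsubseteq> w" using assms by (auto elim: le_trans)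
    then show "?b \<rightarrow> w \<sqsubseteq> ?a" using assms by (simp add: residuation_r)
    show "?a \<sqsubseteq> ?b \<rightarrow> w"
      using l_app[of ?a w] residuation_r[of ?a ?b w] assms by simp
  qed (use assms in auto)
  ultimately show "w = ?a \<cdot> ?b"
    using le_mult_r[of w ?b] assms by simp
qed

section \<open>Orthogonal elements and polars\<close>

lemma orth_iff:
  "\<lbrakk>x \<in> A; y \<in> A\<rbrakk> \<Longrightarrow> orth x y \<longleftrightarrow> (\<forall>z\<in>A. x \<sqsubseteq> z \<and> y \<sqsubseteq> z \<longrightarrow> z = e)"
  by (auto simp: join_is_one_def ph_le_def)

lemma orth_sym: "orth x y \<Longrightarrow> orth y x"
  by (auto simp: join_is_one_def)

lemma orth_dual: "\<lbrakk>x \<in> A; y \<in> A\<rbrakk> \<Longrightarrow> join_is_one A l e x y \<longleftrightarrow> orth x y"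
  by (auto simp: join_is_one_def le_dual)

lemma polar_dual: "M \<subseteq> A \<Longrightarrow> perp A l e M = polar M"
  unfolding perp_def using orth_dual by (auto simp: subset_iff)

lemma polar_subset: "polar M \<subseteq> A"
  by (auto simp: perp_def)

lemma unit_polar: "M \<subseteq> A \<Longrightarrow> e \<in> polar M"
  by (auto simp: perp_def orth_iff subset_iff le_antisym)

text \<open>Both \<open>x\<close> and \<open>y\<close> lie below \<open>g \<rightarrow> h\<close>,
  which is therefore \<open>e\<close>. This acts as a cancellation rule: an inequality may be tested
  after multiplication by each member of an orthogonal pair.\<close>

lemma orth_le_left:
  assumes "orth x y" "x \<cdot> g \<sqsubseteq> h" "y \<cdot> g \<sqsubseteq> h" "x \<in> A" "y \<in> A" "g \<in> A" "h \<in> A"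
  shows "g \<sqsubseteq> h"
proof -
  have "g \<rightarrow> h = e"
    using assms by (simp add: orth_iff residuation_r)
  then show ?thesis by (simp add: ph_le_def)
qed

lemma orth_le_right:
  assumes "orth x y" "g \<cdot> x \<sqsubseteq> h" "g \<cdot> y \<sqsubseteq> h" "x \<in> A" "y \<in> A" "g \<in> A" "h \<in> A"
  shows "g \<sqsubseteq> h"
  using pseudo_hoop_on.orth_le_left[OF dual, of x y g h] assms
  by (simp add: le_dual orth_dual)

lemma orth_mono:
  assumes "orth x y" "x \<sqsubseteq> x'" "x \<in> A" "y \<in> A" "x' \<in> A"
  shows "orth x' y"
  using assms by (auto simp: orth_iff intro: le_trans)

text \<open>For an upper bound \<open>h\<close> of \<open>x \<cdot> y\<close> and \<open>u\<close>,
  both \<open>x \<cdot> y\<close> and \<open>x \<cdot> u\<close> lie below \<open>h\<close>;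
  cancelling the orthogonal pair \<open>y\<close>, \<open>u\<close> gives
  \<open>x \<sqsubseteq> h\<close>, so \<open>h\<close> bounds \<open>x\<close> and
  \<open>u\<close>.\<close>

lemma orth_mult:
  assumes "orth x u" "orth y u" "x \<in> A" "y \<in> A" "u \<in> A"
  shows "orth (x \<cdot> y) u"
proof -
  have "h = e" if h: "h \<in> A" "x \<cdot> y \<sqsubseteq> h" "u \<sqsubseteq> h" for h
  proof -
    have "x \<cdot> u \<sqsubseteq> h"
      using mult_le_right[of x u] h assms by (auto intro: le_trans)
    then have "x \<sqsubseteq> h"
      using orth_le_right[of y u x h] h assms by simp
    then show ?thesis using assms h by (simp add: orth_iff)
  qed
  then show ?thesis using assms by (simp add: orth_iff)
qed

lemma polar_up: "\<lbrakk>x \<in> polar M; x \<sqsubseteq> x'; x' \<in> A; M \<subseteq> A\<rbrakk> \<Longrightarrow> x' \<in> polar M"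
  by (auto simp: perp_def subset_iff intro: orth_mono)

lemma polar_mult: "\<lbrakk>x \<in> polar M; y \<in> polar M; M \<subseteq> A\<rbrakk> \<Longrightarrow> x \<cdot> y \<in> polar M"
  by (auto simp: perp_def subset_iff intro: orth_mult)

lemma orth_r:
  assumes "orth a b" "a \<in> A" "b \<in> A" shows "a \<rightarrow> b = b"
proof (rule le_antisym)
  have "(a \<rightarrow> b) \<cdot> a \<sqsubseteq> b" "(a \<rightarrow> b) \<cdot> b \<sqsubseteq> b"
    using assms by (simp_all add: r_app mult_le_right)
  then show "a \<rightarrow> b \<sqsubseteq> b"
    using orth_le_right[OF assms(1)] assms by simp
  show "b \<sqsubseteq> a \<rightarrow> b" using assms by (simp add: le_r)
qed (use assms in simp_all)

text \<open>By \<open>orth_r\<close> the two sides of the meet identity \<open>meet_rr\<close> are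
  exactly \<open>b \<cdot> a\<close> and \<open>a \<cdot> b\<close>.\<close>

lemma orth_commute:
  assumes "orth a b" "a \<in> A" "b \<in> A" shows "a \<cdot> b = b \<cdot> a"
  using orth_r[of a b] orth_r[of b a] meet_rr[of a b] orth_sym[of a b] assms by simp

text \<open>Absorption is inherited downwards, because \<open>t = c \<cdot> (c \<leadsto> t)\<close>
  has \<open>c\<close> as its left factor.\<close>

lemma mult_fix:
  assumes "z \<cdot> c = c" "t \<sqsubseteq> c" "z \<in> A" "c \<in> A" "t \<in> A" shows "z \<cdot> t = t"
  using assms by (metis mult_assoc le_mult_l l_closed)

section \<open>Normal filters and the congruences they induce\<close>

text \<open>Normality is stated through conjugates: \<open>g \<leadsto> z \<cdot> g\<close> is the
  largest \<open>w\<close> with \<open>g \<cdot> w \<sqsubseteq> z \<cdot> g\<close>, and the other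
  term is its mirror image. The familiar criterion, that both arrows lie in \<open>F\<close>
  simultaneously, is derived in \<open>normal_filter_l_iff_r\<close>.\<close>

definition normal_filter :: "'a set \<Rightarrow> bool" where
  "normal_filter F \<longleftrightarrow> F \<subseteq> A \<and> e \<in> F
     \<and> (\<forall>z\<in>F. \<forall>w\<in>A. z \<sqsubseteq> w \<longrightarrow> w \<in> F)
     \<and> (\<forall>z\<in>F. \<forall>w\<in>F. z \<cdot> w \<in> F)
     \<and> (\<forall>z\<in>F. \<forall>g\<in>A. (g \<leadsto> z \<cdot> g) \<in> F \<and> (g \<rightarrow> g \<cdot> z) \<in> F)"

lemma normal_filter_dual:
  assumes "normal_filter F"
  shows "pseudo_hoop_on.normal_filter A (\<lambda>x y. y \<cdot> x) l r e F"
proof -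
  have F: "F \<subseteq> A" and up: "\<And>z w. \<lbrakk>z \<in> F; w \<in> A; z \<sqsubseteq> w\<rbrakk> \<Longrightarrow> w \<in> F"
    using assms by (simp_all add: normal_filter_def)
  have "w \<in> F" if "z \<in> F" "w \<in> A" "ph_le l e z w" for z w
    using up that F le_dual[of z w] by blast
  then show ?thesis
    using assms unfolding normal_filter_def pseudo_hoop_on.normal_filter_def[OF dual] by blast
qed

lemma normal_filter_up: "\<lbrakk>normal_filter F; z \<in> F; z \<sqsubseteq> w; w \<in> A\<rbrakk> \<Longrightarrow> w \<in> F"
  by (auto simp: normal_filter_def)

lemma normal_filter_mult: "\<lbrakk>normal_filter F; z \<in> F; w \<in> F\<rbrakk> \<Longrightarrow> z \<cdot> w \<in> F"
  by (auto simp: normal_filter_def)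

text \<open>The conjugate of \<open>a \<rightarrow> b\<close> by \<open>a\<close> lies in
  \<open>F\<close>, and it lies below \<open>a \<leadsto> b\<close> since multiplying it by
  \<open>a\<close> on the left lands below \<open>(a \<rightarrow> b) \<cdot> a\<close>.\<close>

lemma normal_filter_r_imp_l:
  assumes F: "normal_filter F" and ab: "(a \<rightarrow> b) \<in> F" "a \<in> A" "b \<in> A"
  shows "(a \<leadsto> b) \<in> F"
proof (rule normal_filter_up[OF F])
  let ?z = "a \<leadsto> (a \<rightarrow> b) \<cdot> a"
  show "?z \<in> F" using F ab unfolding normal_filter_def by blast
  have "a \<cdot> ?z \<sqsubseteq> (a \<rightarrow> b) \<cdot> a" using ab by (intro l_app) auto
  moreover have "(a \<rightarrow> b) \<cdot> a \<sqsubseteq> b" using ab by (intro r_app) auto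
  ultimately have "a \<cdot> ?z \<sqsubseteq> b" using ab by (auto intro: le_trans)
  then show "?z \<sqsubseteq> a \<leadsto> b" using ab by (simp add: residuation_l)
qed (use ab in auto)

lemma normal_filter_l_iff_r:
  assumes "normal_filter F" "a \<in> A" "b \<in> A"
  shows "(a \<leadsto> b) \<in> F \<longleftrightarrow> (a \<rightarrow> b) \<in> F"
  using normal_filter_r_imp_l[of F a b] assms
    pseudo_hoop_on.normal_filter_r_imp_l[OF dual normal_filter_dual, of F a b] by blast

definition filter_cong :: "'a set \<Rightarrow> ('a \<times> 'a) set" where
  "filter_cong F = {(a, b). a \<in> A \<and> b \<in> A \<and> (a \<rightarrow> b) \<in> F \<and> (b \<rightarrow> a) \<in> F}"

text \<open>Normality makes the relation independent of the arrow used, so mirror images of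
  compatibility lemmas concern the same congruence.\<close>

lemma filter_cong_dual:
  assumes "normal_filter F"
  shows "pseudo_hoop_on.filter_cong A l F = filter_cong F"
  unfolding filter_cong_def pseudo_hoop_on.filter_cong_def[OF dual]
  using normal_filter_l_iff_r[OF assms] by auto

lemma r_trans_mult:
  assumes "a \<in> A" "b \<in> A" "c \<in> A"
  shows "(b \<rightarrow> c) \<cdot> (a \<rightarrow> b) \<sqsubseteq> a \<rightarrow> c"
proof -
  have "((b \<rightarrow> c) \<cdot> (a \<rightarrow> b)) \<cdot> a = (b \<rightarrow> c) \<cdot> ((a \<rightarrow> b) \<cdot> a)"
    using assms by (simp add: mult_assoc)
  moreover have "(b \<rightarrow> c) \<cdot> ((a \<rightarrow> b) \<cdot> a) \<sqsubseteq> (b \<rightarrow> c) \<cdot> b"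
    using assms by (intro mult_mono_right r_app) auto
  moreover have "(b \<rightarrow> c) \<cdot> b \<sqsubseteq> c" using assms by (intro r_app) auto
  ultimately have "((b \<rightarrow> c) \<cdot> (a \<rightarrow> b)) \<cdot> a \<sqsubseteq> c"
    using assms by (auto intro: le_trans)
  then show ?thesis using assms by (simp add: residuation_r)
qed

lemma filter_cong_equiv:
  assumes F: "normal_filter F"
  shows "equiv A (filter_cong F)"
proof (rule equivI)
  show "filter_cong F \<subseteq> A \<times> A" by (auto simp: filter_cong_def)
  show "refl_on A (filter_cong F)"
    using F by (auto simp: refl_on_def filter_cong_def normal_filter_def)
  show "sym (filter_cong F)" by (auto simp: sym_def filter_cong_def)
  have "(a \<rightarrow> c) \<in> F" if "(a \<rightarrow> b) \<in> F" "(b \<rightarrow> c) \<in> F" "a \<in> A" "b \<in> A" "c \<in> A" for a b c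
    using normal_filter_up[OF F normal_filter_mult[OF F that(2,1)]] r_trans_mult[of a b c] that
    by simp
  then show "trans (filter_cong F)" unfolding trans_def filter_cong_def by blast
qed

lemma filter_cong_mult_right:
  assumes F: "normal_filter F" and "(a, b) \<in> filter_cong F" "u \<in> A"
  shows "(a \<cdot> u, b \<cdot> u) \<in> filter_cong F"
proof -
  have "(a \<cdot> u \<rightarrow> b \<cdot> u) \<in> F" if "(a \<rightarrow> b) \<in> F" "a \<in> A" "b \<in> A" for a b
  proof (rule normal_filter_up[OF F that(1)])
    have "((a \<rightarrow> b) \<cdot> a) \<cdot> u \<sqsubseteq> b \<cdot> u"
      using that assms(3) by (intro mult_mono_left r_app) auto
    then show "a \<rightarrow> b \<sqsubseteq> a \<cdot> u \<rightarrow> b \<cdot> u"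
      using that assms(3) residuation_r[of "a \<rightarrow> b" "a \<cdot> u" "b \<cdot> u"] by (simp add: mult_assoc)
  qed (use that assms(3) in auto)
  then show ?thesis using assms by (auto simp: filter_cong_def)
qed

lemma filter_cong_mult_left:
  assumes "normal_filter F" "(a, b) \<in> filter_cong F" "u \<in> A"
  shows "(u \<cdot> a, u \<cdot> b) \<in> filter_cong F"
  using pseudo_hoop_on.filter_cong_mult_right[OF dual normal_filter_dual, of F a b u] assms
  by (simp add: filter_cong_dual)

lemma filter_cong_r_left:
  assumes F: "normal_filter F" and "(a, b) \<in> filter_cong F" "u \<in> A"
  shows "(a \<rightarrow> u, b \<rightarrow> u) \<in> filter_cong F"
proof -
  have "((b \<rightarrow> u) \<rightarrow> (a \<rightarrow> u)) \<in> F" if "(a \<rightarrow> b) \<in> F" "a \<in> A" "b \<in> A" for a b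
  proof -
    \<comment> \<open>The factor \<open>a \<rightarrow> b\<close> stands on the right in
      \<open>r_trans_mult\<close>, so residuation produces the other arrow; normality then exchanges
      it for \<open>\<rightarrow>\<close>.\<close>
    have "a \<rightarrow> b \<sqsubseteq> (b \<rightarrow> u) \<leadsto> (a \<rightarrow> u)"
      using r_trans_mult[of a b u] that assms(3) by (simp add: residuation_l)
    then have "((b \<rightarrow> u) \<leadsto> (a \<rightarrow> u)) \<in> F"
      using normal_filter_up[OF F that(1)] that assms(3) by simp
    then show ?thesis using normal_filter_l_iff_r[OF F] that assms(3) by simp
  qed
  then show ?thesis using assms by (auto simp: filter_cong_def)
qed

lemma filter_cong_r_right:
  assumes F: "normal_filter F" and "(a, b) \<in> filter_cong F" "u \<in> A"
  shows "(u \<rightarrow> a, u \<rightarrow> b) \<in> filter_cong F"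
proof -
  have "((u \<rightarrow> a) \<rightarrow> (u \<rightarrow> b)) \<in> F" if "(a \<rightarrow> b) \<in> F" "a \<in> A" "b \<in> A" for a b
    using normal_filter_up[OF F that(1)] r_trans_mult[of u a b] that assms(3)
    by (simp add: residuation_r)
  then show ?thesis using assms by (auto simp: filter_cong_def)
qed

lemma filter_cong_r:
  assumes F: "normal_filter F" and "(a, b) \<in> filter_cong F" "(u, v) \<in> filter_cong F"
  shows "(a \<rightarrow> u, b \<rightarrow> v) \<in> filter_cong F"
proof -
  have "u \<in> A" "b \<in> A" using assms by (auto simp: filter_cong_def)
  then show ?thesis
    using filter_cong_r_left[OF F assms(2)] filter_cong_r_right[OF F assms(3)]
      filter_cong_equiv[OF F] by (meson equivE transE)
qed

lemma filter_cong_mult: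
  assumes F: "normal_filter F" and "(a, b) \<in> filter_cong F" "(u, v) \<in> filter_cong F"
  shows "(a \<cdot> u, b \<cdot> v) \<in> filter_cong F"
proof -
  have "u \<in> A" "b \<in> A" using assms by (auto simp: filter_cong_def)
  then show ?thesis
    using filter_cong_mult_right[OF F assms(2)] filter_cong_mult_left[OF F assms(3)]
      filter_cong_equiv[OF F] by (meson equivE transE)
qed

lemma filter_cong_l:
  assumes "normal_filter F" "(a, b) \<in> filter_cong F" "(u, v) \<in> filter_cong F"
  shows "(a \<leadsto> u, b \<leadsto> v) \<in> filter_cong F"
  using pseudo_hoop_on.filter_cong_r[OF dual normal_filter_dual, of F a b u v] assms
  by (simp add: filter_cong_dual)

lemma filter_cong_congruence: "normal_filter F \<Longrightarrow> ph_congruence A m r l (filter_cong F)"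
  unfolding ph_congruence_def
  using filter_cong_equiv filter_cong_mult filter_cong_r filter_cong_l by blast

lemma filter_cong_ne_Id:
  assumes "normal_filter F" "z \<in> F" "z \<noteq> e"
  shows "filter_cong F \<noteq> Id_on A"
proof
  assume Id: "filter_cong F = Id_on A"
  have "z \<in> A" using assms by (auto simp: normal_filter_def)
  then have "(z, e) \<in> filter_cong F"
    using assms by (simp add: filter_cong_def normal_filter_def)
  with Id assms(3) show False by auto
qed

text \<open>A pair related by both congruences has both its arrows in \<open>F1 \<inter> F2\<close>,
  so both are \<open>e\<close> and antisymmetry applies. Neither congruence is the identity, as a
  nonunit element of a filter is congruent to \<open>e\<close>.\<close>

lemma disjoint_normal_filters_reducible:
  assumes F: "normal_filter F1" "normal_filter F2" "F1 \<inter> F2 = {e}" "F1 \<noteq> {e}" "F2 \<noteq> {e}"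
  shows "subdirectly_reducible A m r l"
proof -
  have "e \<in> F1" "e \<in> F2" using F(3) by auto
  then obtain z w where zw: "z \<in> F1" "z \<noteq> e" "w \<in> F2" "w \<noteq> e"
    using F(4,5) by blast
  have "a = b" if "(a, b) \<in> filter_cong F1 \<inter> filter_cong F2" for a b
  proof -
    have "a \<in> A" "b \<in> A" "(a \<rightarrow> b) \<in> F1 \<inter> F2" "(b \<rightarrow> a) \<in> F1 \<inter> F2"
      using that by (auto simp: filter_cong_def)
    then show ?thesis using F(3) by (auto simp: ph_le_def intro: le_antisym)
  qed
  moreover have "(a, a) \<in> filter_cong F1 \<inter> filter_cong F2" if "a \<in> A" for a
    using that F by (auto simp: filter_cong_def normal_filter_def)
  moreover have "filter_cong F1 \<subseteq> A \<times> A" by (auto simp: filter_cong_def)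
  ultimately have "A \<times> A \<inter> \<Inter>{filter_cong F1, filter_cong F2} = Id_on A"
    by (auto simp: Id_on_def)
  then show ?thesis
    unfolding subdirectly_reducible_def
    using filter_cong_congruence[OF F(1)] filter_cong_congruence[OF F(2)]
      filter_cong_ne_Id[OF F(1) zw(1,2)] filter_cong_ne_Id[OF F(2) zw(3,4)]
    by (intro exI[of _ "{filter_cong F1, filter_cong F2}"]) auto
qed

lemma mult_fix_right:
  assumes "c \<cdot> z = c" "t \<sqsubseteq> c" "z \<in> A" "c \<in> A" "t \<in> A" shows "t \<cdot> z = t"
  using pseudo_hoop_on.mult_fix[OF dual, of c z t] assms by (simp add: le_dual)

end

section \<open>Two mutually polar sets and an element \<open>y\<close> outside their product\<close>

text \<open>The minimality of \<open>c\<close> enters only through \<open>absorb\<close>. The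
  assumptions are symmetric under exchanging \<open>P\<close> and \<open>Q\<close>
  (\<open>swap\<close>) and under reversing the product (\<open>dual_gap\<close>), so each fact is
  proved for \<open>P\<close> and one side only.\<close>

locale polar_gap = pseudo_hoop_on +
  fixes P Q G and c y :: 'a
  assumes P: "P = polar Q" and Q: "Q = polar P"
    and G: "G = {p \<cdot> q | p q. p \<in> P \<and> q \<in> Q}"
    and c: "c \<in> G" and y: "y \<in> A" "y \<notin> G"
    and absorb: "\<And>z. \<lbrakk>z \<in> G; y \<sqsubseteq> z\<rbrakk> \<Longrightarrow> z \<cdot> c = c \<and> c \<cdot> z = c \<and> z \<cdot> y = y \<and> y \<cdot> z = y"
begin

lemma sub: "P \<subseteq> A" "Q \<subseteq> A" "G \<subseteq> A"
proof -
  show "P \<subseteq> A" "Q \<subseteq> A" using P Q polar_subset by metis+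
  then show "G \<subseteq> A" unfolding G by (auto intro!: mult_closed)
qed

lemma orth_PQ: "\<lbrakk>p \<in> P; q \<in> Q\<rbrakk> \<Longrightarrow> orth p q"
  using P by (auto simp: perp_def)

lemma commute_PQ: "\<lbrakk>p \<in> P; q \<in> Q\<rbrakk> \<Longrightarrow> p \<cdot> q = q \<cdot> p"
  using orth_commute orth_PQ sub by blast

lemma G_swap: "G = {q \<cdot> p | p q. p \<in> P \<and> q \<in> Q}"
  unfolding G using commute_PQ by metis

lemma swap: "polar_gap A m r l e Q P G c y"
  using P Q G_swap c y absorb by unfold_locales blast+

lemma dual_gap: "polar_gap A (\<lambda>x y. y \<cdot> x) l r e P Q G c y"
proof -
  interpret d: pseudo_hoop_on A "\<lambda>x y. y \<cdot> x" l r e by (rule dual)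
  show ?thesis
  proof
    show "P = perp A l e Q" "Q = perp A l e P"
      using P Q polar_dual sub by metis+
    show "c \<cdot> z = c \<and> z \<cdot> c = c \<and> y \<cdot> z = y \<and> z \<cdot> y = y" if "z \<in> G" "ph_le l e y z" for z
      using absorb[of z] that y sub le_dual[of y z] by blast
  qed (use G_swap c y in blast)+
qed

lemma unit_P: "e \<in> P"
  and P_up: "\<lbrakk>p \<in> P; p \<sqsubseteq> t; t \<in> A\<rbrakk> \<Longrightarrow> t \<in> P"
  and P_mult: "\<lbrakk>p \<in> P; p' \<in> P\<rbrakk> \<Longrightarrow> p \<cdot> p' \<in> P"
  using P sub unit_polar polar_up polar_mult by metis+

lemma P_sub_G: "P \<subseteq> G"
proof
  fix p assume "p \<in> P"
  moreover from this have "p = p \<cdot> e" using sub by auto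
  ultimately show "p \<in> G" using polar_gap.unit_P[OF swap] G by blast
qed

text \<open>Riesz decomposition splits \<open>t\<close> into factors above those of
  \<open>g\<close>, which remain in \<open>P\<close> and \<open>Q\<close> because polars are upward
  closed.\<close>

lemma G_decomposition:
  assumes "g \<in> G" "g \<sqsubseteq> t" "t \<in> A"
  obtains p q where "p \<in> P" "q \<in> Q" "t = p \<cdot> q"
proof -
  obtain a b where ab: "a \<in> P" "b \<in> Q" "g = a \<cdot> b" using assms(1) G by blast
  then have abA: "a \<in> A" "b \<in> A" using sub by auto
  then obtain p q where pq: "p \<in> A" "q \<in> A" "a \<sqsubseteq> p" "b \<sqsubseteq> q" "t = p \<cdot> q"
    using assms ab riesz_decomposition[of a b t] by blast
  then have "p \<in> P" "q \<in> Q"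
    using P_up[OF ab(1)] polar_gap.P_up[OF swap ab(2)] by auto
  with pq(5) that show thesis by blast
qed

text \<open>If the filter were trivial, any common upper bound of \<open>y\<close> and some
  \<open>p \<in> P\<close> would lie in \<open>P\<close> above \<open>y\<close> and so be
  \<open>e\<close>. Then \<open>y\<close> would be in the polar \<open>Q\<close> of
  \<open>P\<close>, hence in \<open>G\<close>.\<close>

lemma P_nontrivial: "{z \<in> P. y \<sqsubseteq> z} \<noteq> {e}"
proof
  assume *: "{z \<in> P. y \<sqsubseteq> z} = {e}"
  have "orth y p" if "p \<in> P" for p
    using * P_up[OF that] that y sub by (auto simp: orth_iff subset_iff)
  then have "y \<in> Q" using Q y by (simp add: perp_def)
  then show False using polar_gap.P_sub_G[OF swap] y by auto
qed

text \<open>Writing \<open>c = a \<cdot> b\<close>, the inequality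
  \<open>g \<sqsubseteq> g \<cdot> u\<close> is obtained by cancelling twice. On the left the pair
  \<open>z\<close>, \<open>b\<close> leaves \<open>b \<cdot> g\<close>; on the right the pair
  \<open>a\<close>, \<open>u\<close> leaves \<open>(b \<cdot> g) \<cdot> a\<close>, which lies below
  \<open>c\<close> and therefore absorbs \<open>u\<close>.\<close>

lemma mult_ge_imp_fix:
  assumes z: "z \<in> P" and u: "u \<in> Q" "y \<sqsubseteq> u" and g: "g \<in> A" "z \<cdot> g \<sqsubseteq> g \<cdot> u"
  shows "g \<cdot> u = g"
proof -
  obtain a b where ab: "a \<in> P" "b \<in> Q" "c = a \<cdot> b" using c G by blast
  have A: "a \<in> A" "b \<in> A" "z \<in> A" "u \<in> A" "c \<in> A" using ab z u c sub by auto
  have "u \<in> G" using u polar_gap.P_sub_G[OF swap] by auto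
  then have cu: "c \<cdot> u = c" using absorb u by blast
  have "(b \<cdot> g) \<cdot> a \<sqsubseteq> g \<cdot> u"
  proof -
    let ?t = "(b \<cdot> g) \<cdot> a"
    have "?t \<sqsubseteq> b" using A g by (metis le_trans mult_le_left mult_closed)
    moreover have "?t \<sqsubseteq> a" using A g by (simp add: mult_le_right)
    \<comment> \<open>For the orthogonal pair \<open>a\<close>, \<open>b\<close> the meet is the
      product \<open>c\<close>, so a common lower bound is below \<open>c\<close>.\<close>
    moreover have "b \<cdot> (b \<leadsto> a) = a \<cdot> b"
      using orth_r[of b a] orth_sym orth_PQ[OF ab(1,2)] A meet_rl[of b a] by simp
    ultimately have "?t \<sqsubseteq> c" using meet_greatest[of ?t b a] A g ab by simp
    then have "?t = ?t \<cdot> u" using mult_fix_right[OF cu, of ?t] A g by simp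
    moreover have "?t \<sqsubseteq> g" using A g by (metis le_trans mult_le_left mult_le_right mult_closed)
    then have "?t \<cdot> u \<sqsubseteq> g \<cdot> u" using A g by (intro mult_mono_left) auto
    ultimately show ?thesis by simp
  qed
  moreover have "(b \<cdot> g) \<cdot> u \<sqsubseteq> g \<cdot> u"
    using A g by (intro mult_mono_left mult_le_right) auto
  ultimately have "b \<cdot> g \<sqsubseteq> g \<cdot> u"
    using orth_le_right[of a u "b \<cdot> g" "g \<cdot> u"] orth_PQ[OF ab(1) u(1)] A g by simp
  then have "g \<sqsubseteq> g \<cdot> u"
    using orth_le_left[of z b g "g \<cdot> u"] orth_PQ[OF z ab(2)] A g by simp
  then show ?thesis using A g by (intro le_antisym mult_le_left) auto
qed

text \<open>As \<open>g \<cdot> t\<close> lies below \<open>t\<close>, it also absorbs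
  \<open>z\<close>, so \<open>g \<cdot> t = z \<cdot> g \<cdot> t \<sqsubseteq> z \<cdot> g\<close>;
  residuation finishes.\<close>

lemma conj_le:
  assumes "z \<cdot> t = t" "z \<in> A" "t \<in> A" "g \<in> A"
  shows "t \<sqsubseteq> g \<leadsto> z \<cdot> g"
proof -
  have "z \<cdot> (g \<cdot> t) = g \<cdot> t"
    using assms mult_fix[of z t "g \<cdot> t"] mult_le_right by simp
  then have "g \<cdot> t = (z \<cdot> g) \<cdot> t" using assms by (simp add: mult_assoc)
  then have "g \<cdot> t \<sqsubseteq> z \<cdot> g" using assms mult_le_left[of "z \<cdot> g" t] by simp
  then show ?thesis using assms by (simp add: residuation_l)
qed

text \<open>The conjugate \<open>?w\<close> lies above \<open>c\<close>, hence factors as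
  \<open>p \<cdot> q\<close>, and the aim is to show \<open>q = e\<close>. Since
  \<open>z \<cdot> g = g \<cdot> ?w \<sqsubseteq> g \<cdot> q\<close>, the preceding cancellation
  gives \<open>g \<cdot> q = g\<close>, whence \<open>g \<cdot> p = z \<cdot> g\<close> and
  \<open>p \<sqsubseteq> ?w \<sqsubseteq> q\<close>. Thus \<open>q\<close> bounds the orthogonal
  pair \<open>p\<close>, \<open>q\<close>.\<close>

lemma conj_closed:
  assumes z: "z \<in> P" "y \<sqsubseteq> z" and g: "g \<in> A"
  shows "(g \<leadsto> z \<cdot> g) \<in> P \<and> y \<sqsubseteq> g \<leadsto> z \<cdot> g"
proof -
  let ?w = "g \<leadsto> z \<cdot> g"
  have A: "z \<in> A" "c \<in> A" "?w \<in> A" using z c sub g by auto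
  have "z \<in> G" using z P_sub_G by auto
  then have "c \<sqsubseteq> ?w" and yw: "y \<sqsubseteq> ?w"
    using absorb[of z] z A g y conj_le by auto
  then obtain p q where pq: "p \<in> P" "q \<in> Q" "?w = p \<cdot> q"
    using G_decomposition[OF c] A by blast
  have pqA: "p \<in> A" "q \<in> A" using pq sub by auto
  have w: "g \<cdot> ?w = z \<cdot> g" using A g by (intro le_mult_l mult_le_right) auto
  have wq: "?w \<sqsubseteq> q" using pq pqA mult_le_right by simp
  have "y \<sqsubseteq> q" using le_trans[OF yw wq] y A pqA by simp
  moreover have "z \<cdot> g \<sqsubseteq> g \<cdot> q"
    using mult_mono_right[OF wq, of g] w A pqA g by simp
  ultimately have "g \<cdot> q = g" using mult_ge_imp_fix[OF z(1) pq(2)] g by blast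
  then have "g \<cdot> p = g \<cdot> ?w"
    using pq pqA g commute_PQ[OF pq(1,2)] mult_assoc[of g q p] by simp
  then have "p \<sqsubseteq> ?w" using w A pqA g residuation_l[of g p "z \<cdot> g"] by simp
  then have "p \<sqsubseteq> q" using le_trans[OF _ wq] pqA A by blast
  then have "q = e" using orth_PQ[OF pq(1,2)] pqA by (simp add: orth_iff)
  then show ?thesis using pq pqA yw by simp
qed

lemma normal_filter_P: "normal_filter {z \<in> P. y \<sqsubseteq> z}"
  unfolding normal_filter_def
proof (intro conjI ballI impI)
  show "{z \<in> P. y \<sqsubseteq> z} \<subseteq> A" using sub by auto
  show "e \<in> {z \<in> P. y \<sqsubseteq> z}" using unit_P y by simp
next
  fix z w assume "z \<in> {z \<in> P. y \<sqsubseteq> z}" "w \<in> A" "z \<sqsubseteq> w"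
  then show "w \<in> {z \<in> P. y \<sqsubseteq> z}" using P_up le_trans[of y z w] y sub by auto
next
  fix z w assume zw: "z \<in> {z \<in> P. y \<sqsubseteq> z}" "w \<in> {z \<in> P. y \<sqsubseteq> z}"
  then have A: "z \<in> A" "w \<in> A" using sub by auto
  \<comment> \<open>Absorption keeps products above \<open>y\<close>:
    \<open>y = z \<cdot> y \<sqsubseteq> z \<cdot> w\<close>.\<close>
  have "z \<cdot> y = y" using zw absorb P_sub_G by auto
  moreover have "z \<cdot> y \<sqsubseteq> z \<cdot> w" using zw A y by (intro mult_mono_right) auto
  ultimately show "z \<cdot> w \<in> {z \<in> P. y \<sqsubseteq> z}" using P_mult zw by simp
next
  fix z g assume z: "z \<in> {z \<in> P. y \<sqsubseteq> z}" and g: "g \<in> A"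
  then have A: "z \<in> A" using sub by auto
  show "(g \<leadsto> z \<cdot> g) \<in> {z \<in> P. y \<sqsubseteq> z}" using conj_closed z g by auto
  show "(g \<rightarrow> g \<cdot> z) \<in> {z \<in> P. y \<sqsubseteq> z}"
    using polar_gap.conj_closed[OF dual_gap, of z g] z g A y by (auto simp: le_dual)
qed

lemma reducible: "subdirectly_reducible A m r l"
proof (rule disjoint_normal_filters_reducible)
  show "normal_filter {z \<in> P. y \<sqsubseteq> z}" by (rule normal_filter_P)
  show "normal_filter {z \<in> Q. y \<sqsubseteq> z}" by (rule polar_gap.normal_filter_P[OF swap])
  show "{z \<in> P. y \<sqsubseteq> z} \<noteq> {e}" by (rule P_nontrivial)
  show "{z \<in> Q. y \<sqsubseteq> z} \<noteq> {e}" by (rule polar_gap.P_nontrivial[OF swap])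
  have "z = e" if "z \<in> P" "z \<in> Q" for z
    using orth_PQ[OF that] that sub by (auto simp: orth_iff)
  then show "{z \<in> P. y \<sqsubseteq> z} \<inter> {z \<in> Q. y \<sqsubseteq> z} = {e}"
    using unit_P polar_gap.unit_P[OF swap] le_unit[OF y(1)] by blast
qed

end

section \<open>From the least element of \<open>G\<close> above \<open>x\<close> to absorption, and
  the theorem\<close>

context pseudo_hoop_on
begin

lemma polar_polar_polar: "M \<subseteq> A \<Longrightarrow> polar (polar (polar M)) = polar M"
  by (auto simp: perp_def subset_iff intro: orth_sym)

text \<open>With \<open>y = c \<rightarrow> x\<close>, one has \<open>y \<cdot> c = x\<close>, and
  \<open>y\<close> is the largest \<open>t\<close> with \<open>t \<cdot> c \<sqsubseteq> x\<close>.
  The equations for \<open>c\<close> come from its minimality in \<open>G\<close>, those for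
  \<open>y\<close> from its maximality, in the order \<open>z \<cdot> c\<close>,
  \<open>y \<cdot> z\<close>, \<open>c \<cdot> z\<close>, \<open>z \<cdot> y\<close>, later ones
  building on earlier ones.\<close>

lemma least_above_fix:
  assumes G: "G \<subseteq> A" "\<And>a b. \<lbrakk>a \<in> G; b \<in> G\<rbrakk> \<Longrightarrow> a \<cdot> b \<in> G"
    and x: "x \<in> A" and c: "c \<in> G" "x \<sqsubseteq> c" "\<And>a. \<lbrakk>a \<in> G; x \<sqsubseteq> a\<rbrakk> \<Longrightarrow> c \<sqsubseteq> a"
    and z: "z \<in> G" "c \<rightarrow> x \<sqsubseteq> z"
  shows "z \<cdot> c = c \<and> c \<cdot> z = c \<and> z \<cdot> (c \<rightarrow> x) = c \<rightarrow> x \<and> (c \<rightarrow> x) \<cdot> z = c \<rightarrow> x"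
proof -
  define y where "y = c \<rightarrow> x"
  have A: "c \<in> A" "z \<in> A" "y \<in> A" using c z G x by (auto simp: y_def)
  have yc: "y \<cdot> c = x" unfolding y_def using c x A by (intro le_mult_r) auto
  have yz: "y \<sqsubseteq> z" using z by (simp add: y_def)
  have "x \<sqsubseteq> z \<cdot> c" using mult_mono_left[OF yz] A yc by metis
  then have zc: "z \<cdot> c = c" using c(3) G(2)[OF z(1) c(1)] A by (intro le_antisym mult_le_right) auto
  have le_y: "t \<sqsubseteq> y" if "t \<cdot> c \<sqsubseteq> x" "t \<in> A" for t
    using that A x by (simp add: y_def residuation_r)
  have "(z \<rightarrow> y) \<cdot> c = ((z \<rightarrow> y) \<cdot> z) \<cdot> c" using zc A by (simp add: mult_assoc)
  also have "\<dots> = x" using le_mult_r[OF yz] A yc by simp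
  finally have "z \<rightarrow> y \<sqsubseteq> y" using le_y A x by simp
  then have "z \<rightarrow> y = y" using A le_r by (intro le_antisym) auto
  then have y_z: "y \<cdot> z = y" using le_mult_r[OF yz] A by simp
  \<comment> \<open>The relation \<open>y \<cdot> c = x\<close> is one-sided, so
    \<open>c \<cdot> z\<close> is reached through \<open>x\<close>: being below \<open>y\<close>, it
    absorbs \<open>z\<close> on the right, and
    \<open>x = x \<cdot> z \<sqsubseteq> c \<cdot> z\<close>.\<close>
  have "x \<sqsubseteq> y" using A x by (simp add: y_def le_r)
  then have "x \<cdot> z = x" using mult_fix_right[OF y_z] A x by simp
  then have "x \<sqsubseteq> c \<cdot> z" using mult_mono_left[OF c(2), of z] A x by simp
  then have cz: "c \<cdot> z = c" using c(3) G(2)[OF c(1) z(1)] A by (intro le_antisym mult_le_left) auto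
  let ?w = "z \<leadsto> y"
  \<comment> \<open>The product \<open>z \<cdot> (?w \<cdot> c)\<close> is evaluated twice:
    \<open>z\<close> is absorbed because \<open>?w \<cdot> c \<sqsubseteq> c\<close>, while
    \<open>z \<cdot> ?w = y\<close> gives \<open>y \<cdot> c = x\<close>. So
    \<open>?w \<cdot> c = x\<close>.\<close>
  have "z \<cdot> (?w \<cdot> c) = ?w \<cdot> c" using zc A mult_fix[OF zc, of "?w \<cdot> c"] mult_le_right by simp
  moreover have "z \<cdot> (?w \<cdot> c) = x"
    using le_mult_l[OF yz] A yc mult_assoc[of z ?w c] by simp
  ultimately have "?w \<sqsubseteq> y" using le_y A x by simp
  then have "?w = y" using A le_l by (intro le_antisym) auto
  then have "z \<cdot> y = y" using le_mult_l[OF yz] A by simp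
  with zc cz y_z show ?thesis by (simp add: y_def)
qed

end

theorem theorem4p6:
  fixes A :: "'a set" and m r l :: "'a \<Rightarrow> 'a \<Rightarrow> 'a" and e :: 'a and M :: "'a set"
  assumes "pseudo_hoop A m r l e"
    and "M \<subseteq> A"
    and "G = {m a b | a b. a \<in> perp A r e M \<and> b \<in> perp A r e (perp A r e M)}"
    and "x \<in> A" and "x \<notin> G"
    and "\<exists>c\<in>G. ph_le r e x c \<and> (\<forall>a\<in>G. ph_le r e x a \<longrightarrow> ph_le r e c a)"
  shows "subdirectly_reducible A m r l"
proof -
  interpret pseudo_hoop_on A m r l e using assms(1) by unfold_locales
  define P Q where "P = polar M" and "Q = polar (polar M)"
  have PQ: "P = polar Q" "Q = polar P"
    using polar_polar_polar[OF assms(2)] by (auto simp: P_def Q_def)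
  have sub: "P \<subseteq> A" "Q \<subseteq> A" using polar_subset by (auto simp: P_def Q_def)
  have G: "G = {m p q | p q. p \<in> P \<and> q \<in> Q}" using assms(3) by (simp add: P_def Q_def)
  have GA: "G \<subseteq> A" unfolding G using sub by (auto intro!: mult_closed)
  have G_mult: "m a b \<in> G" if ab: "a \<in> G" "b \<in> G" for a b
  proof -
    obtain p q p' q' where *: "p \<in> P" "q \<in> Q" "a = m p q" "p' \<in> P" "q' \<in> Q" "b = m p' q'"
      using ab unfolding G by blast
    have A: "p \<in> A" "q \<in> A" "p' \<in> A" "q' \<in> A" using * sub by auto
    have "p' \<in> polar Q" using *(4) PQ(1) by blast
    then have "orth p' q" using *(2) by (simp add: perp_def)
    \<comment> \<open>The inner factors commute by orthogonality, so the product regroups into a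
      \<open>P\<close>-part and a \<open>Q\<close>-part.\<close>
    then have "m q p' = m p' q" using orth_commute[of p' q] A by simp
    then have "m a b = m (m p p') (m q q')"
      using *(3,6) A by (metis mult_assoc mult_closed)
    moreover have "m p p' \<in> P" "m q q' \<in> Q"
      using polar_mult[of p Q p'] polar_mult[of q P q'] *(1,2,4,5) sub PQ by blast+
    ultimately show ?thesis using G by blast
  qed
  obtain c where c: "c \<in> G" "x \<sqsubseteq> c" "\<And>a. \<lbrakk>a \<in> G; x \<sqsubseteq> a\<rbrakk> \<Longrightarrow> c \<sqsubseteq> a"
    using assms(6) by blast
  have cA: "c \<in> A" using c GA by auto
  interpret polar_gap A m r l e P Q G c "r c x"
  proof
    show "P = polar Q" "Q = polar P" "G = {m p q | p q. p \<in> P \<and> q \<in> Q}" "c \<in> G"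
      by (fact PQ G c)+
    show "r c x \<in> A" using cA assms(4) by simp
    \<comment> \<open>If \<open>r c x\<close> were in \<open>G\<close>, closure under products would
      put \<open>x\<close> in \<open>G\<close>.\<close>
    have "m (r c x) c = x" using c(2) cA assms(4) by (intro le_mult_r) auto
    then show "r c x \<notin> G" using G_mult[OF _ c(1)] assms(5) by metis
  qed (use least_above_fix[OF GA G_mult assms(4) c] in blast)
  show ?thesis by (rule reducible)
qed

end
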